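(* Let $\mathfrak{G}$ be a minimal étale groupoid with compact totally disconnected metrizable unit space $\mathfrak{G}^{(0)}$, let $\Bbbk$ be a field, and let $x\in\mathfrak{G}^{(0)}$. Let $\mathcal{S}$ be a finite set of open compact $\mathfrak{G}$-bisections, and let $V\subset\Bbbk[\mathfrak{G}]$ be the linear span of their characteristic functions and $1_{\mathfrak{G}^{(0)}}$. Then for every $n\ge 1$ \[\dim (V^n\cdot\delta_x)\le\gamma_{\mathcal{S}}(x,n),\] where $\delta_x\in\Bbbk\mathfrak{G}_x$ is the characteristic function of $x\in\mathfrak{G}_x$, and $\gamma_{\mathcal{S}}(x,n)$ is the growth of the Cayley graph based at $x$ of the groupoid generated by the union of the elements of $\mathcal{S}$. Moreover, if the isotropy group of $x$ is trivial, then the $\Bbbk[\mathfrak{G}]$-module $\Bbbk\mathfrak{G}_x$ is simple.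
   Context: A groupoid $\mathfrak{G}$ is (the set of morphisms of) a small category of isomorphisms; $\mathfrak{G}^{(0)}$ is its set of units, $\mathsf{o}(g)=g^{-1}g$ the origin and $\mathsf{t}(g)=gg^{-1}$ the target; $g_1g_2$ is defined iff $\mathsf{t}(g_2)=\mathsf{o}(g_1)$. $\mathfrak{G}_x=\{g\in\mathfrak{G}:\mathsf{o}(g)=x\}$; the isotropy group of $x$ is $\{g:\mathsf{o}(g)=\mathsf{t}(g)=x\}$; the orbit of $x$ is $\mathsf{t}(\mathfrak{G}_x)$. $\mathfrak{G}$ is minimal if every orbit is dense in $\mathfrak{G}^{(0)}$. A topological groupoid has continuous multiplication and inversion and need not be Hausdorff. A $\mathfrak{G}$-bisection is a subset $F$ such that $\mathsf{o}:F\to\mathsf{o}(F)$ and $\mathsf{t}:F\to\mathsf{t}(F)$ are homeomorphisms. $\mathfrak{G}$ is étale if open bisections form a basis of the topology. Compact sets need not be closed or Hausdorff. $\Bbbk[\mathfrak{G}]$ is the $\Bbbk$-algebra generated by the characteristic functions $1_F$ of open compact $\mathfrak{G}$-bisections with respect to convolution $(f_1*f_2)(g)=\sum_{h\in\mathfrak{G}_{\mathsf{o}(g)}}f_1(gh^{-1})f_2(h)$. $\Bbbk\mathfrak{G}_x$ is the space of finitely supported functions $\phi:\mathfrak{G}_x\to\Bbbk$; it is a left $\Bbbk[\mathfrak{G}]$-module by convolution $(f\cdot\phi)(g)=\sum_{h\in\mathfrak{G}_x}f(gh^{-1})\phi(h)$. $V^n$ is the linear span of all products $a_1\cdots a_n$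 with $a_i\in V$, and $V^n\cdot\delta_x=\{a\cdot\delta_x:a\in V^n\}$. With $S=\bigcup\mathcal{S}$, $\gamma_{\mathcal{S}}(x,n)$ is the number of elements of $\mathfrak{G}_x$ that are products of at most $n$ elements of $S\cup S^{-1}$ (the unit $x$ being the empty product), i.e., the cardinality of the ball of radius $n$ around $x$ in the Cayley graph, which has an arrow from $g_1$ to $sg_1$ for each $s\in S$.
   Formalization: Étale is taken in the usual sense: besides open bisections forming a basis of the topology, the origin map is assumed to be open onto the unit space. Without this, the simplicity claim fails, since there may be no nonempty open compact bisections outside the units. *)

theory Defs
  imports "HOL-Analysis.Analysis" "HOL-Library.Function_Algebras"
begin

section \<open>Groupoids\<close>

text \<open>
  A groupoid is given by its set of morphisms; objects are identified with units.
  Composition is a total function whose value is meaningful only on composable pairs.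
\<close>

record 'g groupoid =
  arrows :: "'g set"
  gmult :: "'g \<Rightarrow> 'g \<Rightarrow> 'g"
  ginv :: "'g \<Rightarrow> 'g"

definition origin :: "('g, 'm) groupoid_scheme \<Rightarrow> 'g \<Rightarrow> 'g"
  where "origin G g = gmult G (ginv G g) g"

definition target :: "('g, 'm) groupoid_scheme \<Rightarrow> 'g \<Rightarrow> 'g"
  where "target G g = gmult G g (ginv G g)"

definition units :: "('g, 'm) groupoid_scheme \<Rightarrow> 'g set"
  where "units G = origin G ` arrows G"

locale groupoid =
  fixes G :: "('g, 'm) groupoid_scheme"
  assumes inv_closed: "g \<in> arrows G \<Longrightarrow> ginv G g \<in> arrows G"
    and origin_inv: "g \<in> arrows G \<Longrightarrow> origin G (ginv G g) = target G g"
    and target_inv: "g \<in> arrows G \<Longrightarrow> target G (ginv G g) = origin G g"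
    and mult_closed: "\<lbrakk>g \<in> arrows G; h \<in> arrows G; origin G g = target G h\<rbrakk>
      \<Longrightarrow> gmult G g h \<in> arrows G"
    and origin_mult: "\<lbrakk>g \<in> arrows G; h \<in> arrows G; origin G g = target G h\<rbrakk>
      \<Longrightarrow> origin G (gmult G g h) = origin G h"
    and target_mult: "\<lbrakk>g \<in> arrows G; h \<in> arrows G; origin G g = target G h\<rbrakk>
      \<Longrightarrow> target G (gmult G g h) = target G g"
    and mult_assoc: "\<lbrakk>g \<in> arrows G; h \<in> arrows G; k \<in> arrows G;
        origin G g = target G h; origin G h = target G k\<rbrakk>
      \<Longrightarrow> gmult G (gmult G g h) k = gmult G g (gmult G h k)"
    and mult_origin: "g \<in> arrows G \<Longrightarrow> gmult G g (origin G g) = g"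
    and target_mult_left: "g \<in> arrows G \<Longrightarrow> gmult G (target G g) g = g"

text \<open>The fiber \<open>G\<^sub>x\<close>.\<close>

definition fiber :: "('g, 'm) groupoid_scheme \<Rightarrow> 'g \<Rightarrow> 'g set"
  where "fiber G x = {g \<in> arrows G. origin G g = x}"

definition isotropy :: "('g, 'm) groupoid_scheme \<Rightarrow> 'g \<Rightarrow> 'g set"
  where "isotropy G x = {g \<in> arrows G. origin G g = x \<and> target G g = x}"

definition orbit :: "('g, 'm) groupoid_scheme \<Rightarrow> 'g \<Rightarrow> 'g set"
  where "orbit G x = target G ` fiber G x"

text \<open>
  \<open>word_product G T x k g\<close>: the arrow \<open>g\<close>, with origin \<open>x\<close>, is a product of \<open>k\<close> elements
  of \<open>T\<close>; the empty product is the unit \<open>x\<close>.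
\<close>

inductive word_product ::
  "('g, 'm) groupoid_scheme \<Rightarrow> 'g set \<Rightarrow> 'g \<Rightarrow> nat \<Rightarrow> 'g \<Rightarrow> bool"
  for G T x where
  empty: "word_product G T x 0 x"
| step: "\<lbrakk>word_product G T x k g; s \<in> T; origin G s = target G g\<rbrakk>
    \<Longrightarrow> word_product G T x (Suc k) (gmult G s g)"

definition cayley_ball :: "('g, 'm) groupoid_scheme \<Rightarrow> 'g set set \<Rightarrow> 'g \<Rightarrow> nat \<Rightarrow> 'g set"
  where "cayley_ball G \<S> x n =
    {g \<in> fiber G x. \<exists>k\<le>n. word_product G (\<Union>\<S> \<union> ginv G ` \<Union>\<S>) x k g}"

definition cayley_growth :: "('g, 'm) groupoid_scheme \<Rightarrow> 'g set set \<Rightarrow> 'g \<Rightarrow> nat \<Rightarrow> nat"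
  where "cayley_growth G \<S> x n = card (cayley_ball G \<S> x n)"


section \<open>Etale groupoids\<close>

record 'g top_groupoid = "'g groupoid" +
  gtop :: "'g topology"

locale topological_groupoid = groupoid G
  for G :: "('g, 'm) top_groupoid_scheme" +
  assumes topspace_gtop: "topspace (gtop G) = arrows G"
    and continuous_inv: "continuous_map (gtop G) (gtop G) (ginv G)"
    and continuous_mult:
      "continuous_map
        (subtopology (prod_topology (gtop G) (gtop G))
          {(g, h). g \<in> arrows G \<and> h \<in> arrows G \<and> origin G g = target G h})
        (gtop G) (\<lambda>(g, h). gmult G g h)"

definition unit_space :: "('g, 'm) top_groupoid_scheme \<Rightarrow> 'g topology"
  where "unit_space G = subtopology (gtop G) (units G)"

definition bisection :: "('g, 'm) top_groupoid_scheme \<Rightarrow> 'g set \<Rightarrow> bool"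
  where "bisection G F \<longleftrightarrow> F \<subseteq> arrows G \<and>
    homeomorphic_map (subtopology (gtop G) F) (subtopology (gtop G) (origin G ` F)) (origin G) \<and>
    homeomorphic_map (subtopology (gtop G) F) (subtopology (gtop G) (target G ` F)) (target G)"

definition open_compact_bisection :: "('g, 'm) top_groupoid_scheme \<Rightarrow> 'g set \<Rightarrow> bool"
  where "open_compact_bisection G F \<longleftrightarrow>
    bisection G F \<and> openin (gtop G) F \<and> compactin (gtop G) F"

text \<open>
  Besides the basis of open bisections we record that \<open>origin\<close> is an open map onto the unit space
  (equivalently, by inversion, \<open>target\<close> is), so that origin and target are local homeomorphisms.
  This is part of the usual meaning of ``etale''; it does not follow from \<^const>\<open>bisection\<close>,
  which only compares \<open>F\<close> with the subspace \<open>origin G ` F\<close> (e.g. adjoin to a unit space one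
  isolated arrow of order two at a non-isolated unit).
\<close>

locale etale_groupoid = topological_groupoid G
  for G :: "('g, 'm) top_groupoid_scheme" +
  assumes bisections_basis:
      "openin (gtop G) = arbitrary union_of (\<lambda>F. openin (gtop G) F \<and> bisection G F)"
    and origin_open: "open_map (gtop G) (unit_space G) (origin G)"

definition minimal_groupoid :: "('g, 'm) top_groupoid_scheme \<Rightarrow> bool"
  where "minimal_groupoid G \<longleftrightarrow>
    (\<forall>x\<in>units G. unit_space G closure_of orbit G x = units G)"

definition totally_disconnected_space :: "'a topology \<Rightarrow> bool"
  where "totally_disconnected_space X \<longleftrightarrow> (\<forall>C. connectedin X C \<longrightarrow> (\<exists>a. C \<subseteq> {a}))"


section \<open>The convolution algebra and its modules\<close>

text \<open>
  Functions on arrows are functions on the whole type vanishing outside the groupoid; addition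
  is pointwise.
\<close>

definition fscale :: "'k::field \<Rightarrow> ('g \<Rightarrow> 'k) \<Rightarrow> 'g \<Rightarrow> 'k"
  where "fscale c f = (\<lambda>g. c * f g)"

interpretation fun_space: vector_space fscale
  by unfold_locales (auto simp: fscale_def fun_eq_iff algebra_simps)

text \<open>
  Both sums below run over the nonzero terms only, as HOL sums over infinite sets are \<open>0\<close>.
  For the functions under consideration there are finitely many nonzero terms.
\<close>

definition convolution ::
  "('g, 'm) groupoid_scheme \<Rightarrow> ('g \<Rightarrow> 'k::field) \<Rightarrow> ('g \<Rightarrow> 'k) \<Rightarrow> 'g \<Rightarrow> 'k"
  where "convolution G f1 f2 = (\<lambda>g. if g \<in> arrows G
    then \<Sum>h | h \<in> fiber G (origin G g) \<and> f1 (gmult G g (ginv G h)) * f2 h \<noteq> 0.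
           f1 (gmult G g (ginv G h)) * f2 h
    else 0)"

definition fiber_action ::
  "('g, 'm) groupoid_scheme \<Rightarrow> 'g \<Rightarrow> ('g \<Rightarrow> 'k::field) \<Rightarrow> ('g \<Rightarrow> 'k) \<Rightarrow> 'g \<Rightarrow> 'k"
  where "fiber_action G x f \<phi> = (\<lambda>g. if g \<in> fiber G x
    then \<Sum>h | h \<in> fiber G x \<and> f (gmult G g (ginv G h)) * \<phi> h \<noteq> 0.
           f (gmult G g (ginv G h)) * \<phi> h
    else 0)"

inductive_set groupoid_algebra :: "('g, 'm) top_groupoid_scheme \<Rightarrow> ('g \<Rightarrow> 'k::field) set"
  for G where
  bisection: "open_compact_bisection G F \<Longrightarrow> indicator F \<in> groupoid_algebra G"
| zero: "0 \<in> groupoid_algebra G"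
| add: "\<lbrakk>f1 \<in> groupoid_algebra G; f2 \<in> groupoid_algebra G\<rbrakk> \<Longrightarrow> f1 + f2 \<in> groupoid_algebra G"
| scale: "f \<in> groupoid_algebra G \<Longrightarrow> fscale c f \<in> groupoid_algebra G"
| convolution: "\<lbrakk>f1 \<in> groupoid_algebra G; f2 \<in> groupoid_algebra G\<rbrakk>
    \<Longrightarrow> convolution G f1 f2 \<in> groupoid_algebra G"

definition fiber_module :: "('g, 'm) groupoid_scheme \<Rightarrow> 'g \<Rightarrow> ('g \<Rightarrow> 'k::field) set"
  where "fiber_module G x = {\<phi>. finite {g. \<phi> g \<noteq> 0} \<and> {g. \<phi> g \<noteq> 0} \<subseteq> fiber G x}"

fun convolution_list :: "('g, 'm) groupoid_scheme \<Rightarrow> ('g \<Rightarrow> 'k::field) list \<Rightarrow> 'g \<Rightarrow> 'k"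
  where
  "convolution_list G [] = indicator (units G)"
| "convolution_list G [a] = a"
| "convolution_list G (a # b # as) = convolution G a (convolution_list G (b # as))"

definition span_power ::
  "('g, 'm) groupoid_scheme \<Rightarrow> ('g \<Rightarrow> 'k::field) set \<Rightarrow> nat \<Rightarrow> ('g \<Rightarrow> 'k) set"
  where "span_power G V n =
    fun_space.span {convolution_list G as | as. length as = n \<and> set as \<subseteq> V}"

definition submodule ::
  "'r set \<Rightarrow> ('r \<Rightarrow> 'b \<Rightarrow> 'b) \<Rightarrow> 'b::ab_group_add set \<Rightarrow> 'b set \<Rightarrow> bool"
  where "submodule A act M N \<longleftrightarrow> N \<subseteq> M \<and> 0 \<in> N \<and> (\<forall>u\<in>N. \<forall>v\<in>N. u + v \<in> N) \<and>
    (\<forall>u\<in>N. - u \<in> N) \<and> (\<forall>a\<in>A. \<forall>u\<in>N. act a u \<in> N)"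

definition simple_module :: "'r set \<Rightarrow> ('r \<Rightarrow> 'b \<Rightarrow> 'b) \<Rightarrow> 'b::ab_group_add set \<Rightarrow> bool"
  where "simple_module A act M \<longleftrightarrow>
    submodule A act M M \<and> M \<noteq> {0} \<and> (\<forall>N. submodule A act M N \<longrightarrow> N = {0} \<or> N = M)"

end

theory Submission
  imports Defs
begin

text \<open>
  For \<open>a \<in> V\<^sup>n\<close>, the vector \<open>a \<cdot> \<delta>\<^sub>x\<close> is the restriction of \<open>a\<close> to the fiber \<open>G\<^sub>x\<close>. An element of \<open>V\<close> is
  supported on \<open>G\<^sup>0 \<union> \<Union>\<S>\<close>, and a convolution is supported on products of arrows of the two supports,
  so this restriction is supported on the arrows of \<open>G\<^sub>x\<close> that are products of at most \<open>n\<close> elements of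
  \<open>\<Union>\<S>\<close> (lemma \<open>convolution_list_support\<close>). Hence \<open>V\<^sup>n \<cdot> \<delta>\<^sub>x\<close> lies in the space spanned by the point
  masses on the ball of radius \<open>n\<close>. The ball is finite because a bisection contains at most one
  arrow with a given origin and at most one with a given target.

  For simplicity of \<open>kG\<^sub>x\<close>, let \<open>\<phi> \<noteq> 0\<close> belong to a submodule, let \<open>\<phi> g \<noteq> 0\<close>, and let \<open>h \<in> G\<^sub>x\<close>. When
  the isotropy group of \<open>x\<close> is trivial, the target map is injective on \<open>G\<^sub>x\<close>. The unit space has a
  basis of clopen sets, so the unit \<open>target g\<close> can be separated from the finitely many other targets
  of the support of \<open>\<phi>\<close>, and there is an open compact bisection \<open>F\<close> through \<open>h g\<^sup>-\<^sup>1\<close> whose origins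
  avoid those other targets. Then \<open>1\<^sub>F \<cdot> \<phi> = \<phi> g \<delta>\<^sub>h\<close>. So the submodule contains all multiples of all
  point masses, hence everything.
\<close>

section \<open>Clopen neighbourhoods in compact totally disconnected spaces\<close>

text \<open>
  If a quasi-component \<open>C\<close> were split by two closed sets, normality would thicken the pieces to
  disjoint open sets \<open>U\<close> and \<open>V\<close>. The compact rest of the space misses \<open>C\<close>, so some clopen \<open>W\<close>
  contains \<open>C\<close> and lies in \<open>U \<union> V\<close>. Then \<open>W \<inter> U\<close> is clopen and cuts \<open>C\<close>, which is impossible.
\<close>

lemma connectedin_quasi_component_of_compact_Hausdorff:
  assumes compact: "compact_space X" and Hausdorff: "Hausdorff_space X"
    and C: "C \<in> quasi_components_of X"
  shows "connectedin X C"
  unfolding connectedin_closedin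
proof (intro conjI notI)
  show "C \<subseteq> topspace X"
    using C by (rule quasi_components_of_subset)
next
  assume "\<exists>E1 E2. closedin X E1 \<and> closedin X E2 \<and>
    C \<subseteq> E1 \<union> E2 \<and> E1 \<inter> E2 \<inter> C = {} \<and> E1 \<inter> C \<noteq> {} \<and> E2 \<inter> C \<noteq> {}"
  then obtain E1 E2 where E: "closedin X E1" "closedin X E2" "C \<subseteq> E1 \<union> E2"
    "E1 \<inter> E2 \<inter> C = {}" "E1 \<inter> C \<noteq> {}" "E2 \<inter> C \<noteq> {}"
    by blast
  have "closedin X C"
    using C by (rule closedin_quasi_components_of)
  then have "closedin X (E1 \<inter> C)" "closedin X (E2 \<inter> C)" "disjnt (E1 \<inter> C) (E2 \<inter> C)"
    using E by (auto simp: disjnt_def)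
  moreover have "normal_space X"
    using compact Hausdorff compact_Hausdorff_or_regular_imp_normal_space by blast
  ultimately obtain U V where UV: "openin X U" "openin X V" "E1 \<inter> C \<subseteq> U" "E2 \<inter> C \<subseteq> V" "disjnt U V"
    unfolding normal_space_def by meson
  define K where "K = topspace X - (U \<union> V)"
  have "compactin X K"
    unfolding K_def using UV compact by (intro closedin_compact_space closedin_diff) auto
  moreover have "disjnt C K"
    using UV E by (auto simp: disjnt_def K_def)
  ultimately have "separated_between X C K"
    using C by (simp add: separated_between_quasi_component_compact)
  then obtain W where W: "closedin X W" "openin X W" "C \<subseteq> W" "K \<subseteq> topspace X - W"
    unfolding separated_between by blast
  have "W \<inter> U = W - V"
    using W UV closedin_subset[OF W(1)] by (auto simp: K_def disjnt_def)
  moreover have "closedin X (W - V)"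
    using W(1) UV(2) by (rule closedin_diff)
  ultimately have "closedin X (W \<inter> U)"
    by simp
  moreover have "openin X (W \<inter> U)"
    using W(2) UV(1) by (rule openin_Int)
  ultimately have "C \<subseteq> W \<inter> U \<or> disjnt C (W \<inter> U)"
    using quasi_component_of_clopen_cases[OF C] by blast
  moreover obtain e1 e2 where "e1 \<in> E1 \<inter> C" "e2 \<in> E2 \<inter> C"
    using E by blast
  moreover from this have "e1 \<in> W \<inter> U" "e2 \<notin> U"
    using UV W by (auto simp: disjnt_iff)
  ultimately show False
    by (auto simp: disjnt_iff)
qed

lemma clopen_neighbourhood:
  assumes compact: "compact_space X" and Hausdorff: "Hausdorff_space X"
    and td: "totally_disconnected_space X"
    and U: "openin X U" "u \<in> U"
  obtains W where "closedin X W" "openin X W" "u \<in> W" "W \<subseteq> U"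
proof -
  have u: "u \<in> topspace X"
    using U openin_subset by blast
  let ?C = "quasi_component_of_set X u"
  have C: "?C \<in> quasi_components_of X"
    using u by (simp add: quasi_component_in_quasi_components_of)
  then obtain a where "?C \<subseteq> {a}"
    using connectedin_quasi_component_of_compact_Hausdorff[OF compact Hausdorff] td
    unfolding totally_disconnected_space_def by blast
  moreover have "u \<in> ?C"
    using u by simp
  ultimately have "?C = {u}"
    by blast
  moreover have "compactin X (topspace X - U)"
    using compact U by (intro closedin_compact_space closedin_diff) auto
  ultimately have "separated_between X {u} (topspace X - U)"
    using separated_between_quasi_component_compact[OF C] U by (simp add: disjnt_def)
  then obtain W where W: "closedin X W" "openin X W" "{u} \<subseteq> W" "topspace X - U \<subseteq> topspace X - W"
    unfolding separated_between by blast
  then have "W \<subseteq> U"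
    using closedin_subset[OF W(1)] by blast
  with W show thesis
    using that by blast
qed


section \<open>Groupoid identities\<close>

context groupoid
begin

lemma unit_arrow:
  assumes "u \<in> units G"
  shows "u \<in> arrows G" "origin G u = u" "target G u = u"
proof -
  obtain g where g: "g \<in> arrows G" "u = origin G g"
    using assms by (auto simp: units_def)
  then have u: "u = gmult G (ginv G g) g"
    by (simp add: origin_def)
  show "u \<in> arrows G"
    unfolding u using g by (intro mult_closed inv_closed) (auto simp: origin_inv)
  show "origin G u = u"
    using g origin_mult[of "ginv G g" g] by (simp add: u inv_closed origin_inv flip: origin_def)
  show "target G u = u"
    using g target_mult[of "ginv G g" g] by (simp add: u inv_closed origin_inv target_inv flip: origin_def)
qed

lemma ginv_unit:
  assumes "u \<in> units G"
  shows "ginv G u = u"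
proof -
  note u = unit_arrow[OF assms]
  have "ginv G u = gmult G (target G (ginv G u)) (ginv G u)"
    using u inv_closed target_mult_left by metis
  also have "\<dots> = target G u"
    using u by (simp add: target_inv) (simp add: target_def)
  finally show ?thesis
    using u by simp
qed

lemma origin_in_units: "g \<in> arrows G \<Longrightarrow> origin G g \<in> units G"
  by (simp add: units_def)

lemma target_in_units: "g \<in> arrows G \<Longrightarrow> target G g \<in> units G"
  using origin_in_units[of "ginv G g"] by (simp add: inv_closed origin_inv)

text \<open>These identities turn a nonzero term of a convolution at \<open>g\<close>, indexed by \<open>h\<close>, into the
  factorization \<open>g = (g h\<^sup>-\<^sup>1) h\<close>.\<close>

lemma right_division:
  assumes "g \<in> arrows G" "h \<in> arrows G" "origin G g = origin G h"
  shows "gmult G g (ginv G h) \<in> arrows G"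
    and "origin G (gmult G g (ginv G h)) = target G h"
    and "target G (gmult G g (ginv G h)) = target G g"
    and "gmult G (gmult G g (ginv G h)) h = g"
proof -
  note h = inv_closed[OF assms(2)] origin_inv[OF assms(2)] target_inv[OF assms(2)]
  show "gmult G g (ginv G h) \<in> arrows G"
    using assms h by (intro mult_closed) auto
  show "origin G (gmult G g (ginv G h)) = target G h"
    using assms h by (simp add: origin_mult)
  show "target G (gmult G g (ginv G h)) = target G g"
    using assms h by (simp add: target_mult)
  have "gmult G (gmult G g (ginv G h)) h = gmult G g (gmult G (ginv G h) h)"
    using assms h by (intro mult_assoc) auto
  also have "\<dots> = g"
    using assms mult_origin[of g] by (simp add: origin_def[of G h])
  finally show "gmult G (gmult G g (ginv G h)) h = g" .
qed

text \<open>Two arrows of \<open>G\<^sub>x\<close> with the same target differ by an element of the isotropy group of \<open>x\<close>.\<close>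

lemma target_inj_on_fiber:
  assumes isotropy: "isotropy G x = {x}"
  shows "inj_on (target G) (fiber G x)"
proof (rule inj_onI)
  fix g h
  assume "g \<in> fiber G x" "h \<in> fiber G x" and eq: "target G g = target G h"
  then have g: "g \<in> arrows G" "origin G g = x" and h: "h \<in> arrows G" "origin G h = x"
    by (auto simp: fiber_def)
  let ?k = "gmult G (ginv G h) g"
  have "?k \<in> isotropy G x"
    using g h eq
    by (simp add: isotropy_def mult_closed inv_closed origin_inv target_inv origin_mult target_mult)
  then have k: "?k = x"
    using isotropy by blast
  have "h = gmult G h ?k"
    using k h mult_origin by metis
  also have "\<dots> = gmult G (gmult G h (ginv G h)) g"
    using g h eq by (intro mult_assoc[symmetric]) (auto simp: inv_closed origin_inv target_inv)
  also have "\<dots> = g"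
    using g eq target_mult_left[of g] by (simp add: target_def[of G h])
  finally show "g = h" ..
qed


section \<open>Finite Cayley balls\<close>

lemma word_product_mono:
  assumes "word_product G T x k g" "T \<subseteq> T'"
  shows "word_product G T' x k g"
  using assms by induction (auto intro: word_product.intros)

lemma word_product_in_fiber:
  assumes "word_product G T x k g" and T: "T \<subseteq> arrows G" and x: "x \<in> units G"
  shows "g \<in> fiber G x"
  using assms(1)
proof induction
  case empty
  then show ?case
    using unit_arrow[OF x] by (simp add: fiber_def)
next
  case (step k g s)
  then show ?case
    using T by (auto simp: fiber_def mult_closed origin_mult)
qed

lemma finite_word_products:
  assumes "\<And>u. finite {s \<in> T. origin G s = u}"
  shows "finite {g. word_product G T x k g}"
proof (induction k)
  case 0
  have "{g. word_product G T x 0 g} \<subseteq> {x}"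
    by (auto elim: word_product.cases)
  then show ?case
    using finite_subset by blast
next
  case (Suc k)
  have "{g. word_product G T x (Suc k) g} \<subseteq>
      (\<Union>g \<in> {g. word_product G T x k g}. (\<lambda>s. gmult G s g) ` {s \<in> T. origin G s = target G g})"
  proof
    fix g'
    assume "g' \<in> {g. word_product G T x (Suc k) g}"
    then have "word_product G T x (Suc k) g'"
      by simp
    then obtain g s where "g' = gmult G s g" "word_product G T x k g" "s \<in> T" "origin G s = target G g"
      by cases
    then show "g' \<in> (\<Union>g \<in> {g. word_product G T x k g}.
        (\<lambda>s. gmult G s g) ` {s \<in> T. origin G s = target G g})"
      by blast
  qed
  then show ?case
    by (rule finite_subset) (use Suc assms in auto)
qed

end

lemma bisection_subset: "bisection G F \<Longrightarrow> F \<subseteq> arrows G"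
  by (simp add: bisection_def)

context topological_groupoid
begin

lemma bisection_inj:
  assumes "bisection G F"
  shows "inj_on (origin G) F" and "inj_on (target G) F"
proof -
  have F: "topspace (subtopology (gtop G) F) = F"
    using bisection_subset[OF assms] topspace_gtop by auto
  show "inj_on (origin G) F" "inj_on (target G) F"
    using assms homeomorphic_imp_injective_map F unfolding bisection_def by metis+
qed

lemma finite_bisection_fiber:
  assumes "bisection G F"
  shows "finite {g \<in> F. origin G g = u}" and "finite {g \<in> F. target G g = u}"
proof -
  have *: "finite {g \<in> F. f g = u}" if "inj_on f F" for f :: "'g \<Rightarrow> 'g"
  proof (rule finite_imageD)
    show "finite (f ` {g \<in> F. f g = u})"
      by (rule finite_subset[of _ "{u}"]) auto
    show "inj_on f {g \<in> F. f g = u}"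
      using that by (rule inj_on_subset) auto
  qed
  show "finite {g \<in> F. origin G g = u}" "finite {g \<in> F. target G g = u}"
    using bisection_inj[OF assms] by (auto intro: *)
qed

lemma finite_cayley_ball:
  assumes "finite \<S>" and bis: "\<And>F. F \<in> \<S> \<Longrightarrow> bisection G F"
  shows "finite (cayley_ball G \<S> x n)"
proof -
  let ?T = "\<Union>\<S> \<union> ginv G ` \<Union>\<S>"
  have "finite {s \<in> ?T. origin G s = u}" for u
  proof (rule finite_subset)
    show "{s \<in> ?T. origin G s = u} \<subseteq>
      (\<Union>F\<in>\<S>. {g \<in> F. origin G g = u} \<union> ginv G ` {g \<in> F. target G g = u})"
    proof
      fix s
      assume s: "s \<in> {s \<in> ?T. origin G s = u}"
      then consider F where "F \<in> \<S>" "s \<in> F" | F g where "F \<in> \<S>" "g \<in> F" "s = ginv G g"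
        by blast
      then show "s \<in> (\<Union>F\<in>\<S>. {g \<in> F. origin G g = u} \<union> ginv G ` {g \<in> F. target G g = u})"
      proof cases
        case 1
        then show ?thesis
          using s by blast
      next
        case 2
        then have "target G g = u"
          using s bisection_subset[OF bis[OF 2(1)]] origin_inv[of g] by auto
        then show ?thesis
          using 2 by blast
      qed
    qed
    show "finite (\<Union>F\<in>\<S>. {g \<in> F. origin G g = u} \<union> ginv G ` {g \<in> F. target G g = u})"
      using \<open>finite \<S>\<close> finite_bisection_fiber[OF bis] by auto
  qed
  then have "finite (\<Union>k\<le>n. {g. word_product G ?T x k g})"
    using finite_word_products by blast
  then show ?thesis
    by (rule finite_subset[rotated]) (auto simp: cayley_ball_def)
qed

end


section \<open>Supports of convolutions\<close>

lemma nonzero_sum_has_nonzero_term: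
  "(\<Sum>h | h \<in> A \<and> f h \<noteq> 0. f h) \<noteq> 0 \<Longrightarrow> \<exists>h\<in>A. f h \<noteq> 0"
  by (metis (mono_tags, lifting) mem_Collect_eq sum.not_neutral_contains_not_neutral)

lemma convolution_nonzeroE:
  assumes "convolution G f1 f2 g \<noteq> 0"
  obtains h where "g \<in> arrows G" "h \<in> fiber G (origin G g)"
    "f1 (gmult G g (ginv G h)) \<noteq> 0" "f2 h \<noteq> 0"
proof -
  have g: "g \<in> arrows G"
    using assms by (auto simp: convolution_def split: if_splits)
  then have "\<exists>h \<in> fiber G (origin G g). f1 (gmult G g (ginv G h)) * f2 h \<noteq> 0"
    using assms by (intro nonzero_sum_has_nonzero_term) (simp add: convolution_def)
  then show thesis
    using g that by auto
qed

lemma fiber_action_nonzeroE: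
  assumes "fiber_action G x a \<phi> g \<noteq> 0"
  obtains h where "g \<in> fiber G x" "h \<in> fiber G x" "a (gmult G g (ginv G h)) \<noteq> 0" "\<phi> h \<noteq> 0"
proof -
  have g: "g \<in> fiber G x"
    using assms by (auto simp: fiber_action_def split: if_splits)
  then have "\<exists>h \<in> fiber G x. a (gmult G g (ginv G h)) * \<phi> h \<noteq> 0"
    using assms by (intro nonzero_sum_has_nonzero_term) (simp add: fiber_action_def)
  then show thesis
    using g that by auto
qed

lemma fiber_action_eq_sum:
  assumes "finite S" "S \<subseteq> fiber G x" "\<And>h. h \<in> fiber G x - S \<Longrightarrow> \<phi> h = 0" "g \<in> fiber G x"
  shows "fiber_action G x a \<phi> g = (\<Sum>h\<in>S. a (gmult G g (ginv G h)) * \<phi> h)"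
proof -
  have "(\<Sum>h | h \<in> fiber G x \<and> a (gmult G g (ginv G h)) * \<phi> h \<noteq> 0. a (gmult G g (ginv G h)) * \<phi> h)
      = (\<Sum>h\<in>S. a (gmult G g (ginv G h)) * \<phi> h)"
  proof (rule sum.mono_neutral_left)
    show "{h. h \<in> fiber G x \<and> a (gmult G g (ginv G h)) * \<phi> h \<noteq> 0} \<subseteq> S"
      using assms(3) by force
    show "\<forall>h \<in> S - {h. h \<in> fiber G x \<and> a (gmult G g (ginv G h)) * \<phi> h \<noteq> 0}.
        a (gmult G g (ginv G h)) * \<phi> h = 0"
      using assms(2) by blast
  qed (rule assms(1))
  then show ?thesis
    using assms(4) by (simp add: fiber_action_def)
qed

lemma subspace_supported_on:
  "fun_space.subspace {f :: 'g \<Rightarrow> 'k::field. \<forall>g. f g \<noteq> 0 \<longrightarrow> g \<in> A}"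
proof (rule fun_space.subspaceI)
  fix u v :: "'g \<Rightarrow> 'k"
  assume uv: "u \<in> {f. \<forall>g. f g \<noteq> 0 \<longrightarrow> g \<in> A}" "v \<in> {f. \<forall>g. f g \<noteq> 0 \<longrightarrow> g \<in> A}"
  have "u g = 0 \<and> v g = 0" if "g \<notin> A" for g
    using uv that by blast
  then have "(u + v) g = 0" if "g \<notin> A" for g
    using that by simp
  then show "u + v \<in> {f. \<forall>g. f g \<noteq> 0 \<longrightarrow> g \<in> A}"
    by blast
qed (auto simp: fscale_def)

lemma span_supported_on:
  assumes "f \<in> fun_space.span B" "\<And>b g. b \<in> B \<Longrightarrow> b g \<noteq> 0 \<Longrightarrow> g \<in> A" "f g \<noteq> 0"
  shows "g \<in> A"
  using fun_space.span_minimal[OF _ subspace_supported_on[of A], of B] assms by blast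

text \<open>
  The set \<open>N\<close> is only required to be closed under addition, so that the lemma covers both linear
  spans and submodules, whose definition does not mention scalars.
\<close>

lemma finitely_supported_in_additive_set:
  fixes N :: "('g \<Rightarrow> 'k::field) set"
  assumes "finite S" "{g. \<phi> g \<noteq> 0} \<subseteq> S"
    and zero: "0 \<in> N" and add: "\<And>u v. u \<in> N \<Longrightarrow> v \<in> N \<Longrightarrow> u + v \<in> N"
    and points: "\<And>c h. h \<in> S \<Longrightarrow> fscale c (indicator {h}) \<in> N"
  shows "\<phi> \<in> N"
  using assms(1,2) points
proof (induction S arbitrary: \<phi>)
  case empty
  then have "\<phi> = 0"
    by (auto simp: fun_eq_iff)
  with zero show ?case
    by metis
next
  case (insert h S)
  have "{g. (\<phi>(h := 0)) g \<noteq> 0} \<subseteq> S"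
  proof
    fix g
    assume "g \<in> {g. (\<phi>(h := 0)) g \<noteq> 0}"
    then have "g \<noteq> h" "g \<in> {g. \<phi> g \<noteq> 0}"
      by (simp_all split: if_splits)
    then show "g \<in> S"
      using insert.prems(1) by blast
  qed
  then have "\<phi>(h := 0) \<in> N"
    by (rule insert.IH) (use insert.prems(2) in simp)
  moreover have "fscale (\<phi> h) (indicator {h}) \<in> N"
    using insert.prems(2) by simp
  ultimately have "\<phi>(h := 0) + fscale (\<phi> h) (indicator {h}) \<in> N"
    by (rule add)
  also have "\<phi>(h := 0) + fscale (\<phi> h) (indicator {h}) = \<phi>"
    by (auto simp: fun_eq_iff fscale_def)
  finally show ?case .
qed

lemma in_span_point_masses:
  fixes \<phi> :: "'g \<Rightarrow> 'k::field"
  assumes "finite A" "{g. \<phi> g \<noteq> 0} \<subseteq> A"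
  shows "\<phi> \<in> fun_space.span ((\<lambda>h. indicator {h}) ` A)"
  using assms
  by (rule finitely_supported_in_additive_set)
    (auto intro: fun_space.span_zero fun_space.span_add fun_space.span_scale fun_space.span_base)


section \<open>The growth estimate\<close>

context groupoid
begin

lemma fiber_action_unit_mass:
  assumes x: "x \<in> units G"
  shows "fiber_action G x a (indicator {x}) = (\<lambda>g. if g \<in> fiber G x then a g else 0)"
proof
  fix g
  note ux = unit_arrow[OF x]
  show "fiber_action G x a (indicator {x}) g = (if g \<in> fiber G x then a g else 0)"
  proof (cases "g \<in> fiber G x")
    case True
    then have "gmult G g (ginv G x) = g"
      using mult_origin[of g] ginv_unit[OF x] by (auto simp: fiber_def)
    moreover have "{x} \<subseteq> fiber G x"
      using ux by (simp add: fiber_def)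
    ultimately show ?thesis
      using True fiber_action_eq_sum[of "{x}" G x "indicator {x}" g a] by auto
  qed (simp add: fiber_action_def)
qed

text \<open>
  If a convolution does not vanish at \<open>g\<close>, then \<open>g = (g h\<^sup>-\<^sup>1) h\<close> with \<open>g h\<^sup>-\<^sup>1\<close> in the support of the
  first factor and \<open>h\<close> in the support of the second. A unit as first factor does not lengthen
  the word, and any other first factor is one more letter.
\<close>

lemma convolution_list_support:
  assumes x: "x \<in> units G" and T: "T \<subseteq> arrows G"
  shows "\<lbrakk>as \<noteq> []; \<And>a g. a \<in> set as \<Longrightarrow> a g \<noteq> 0 \<Longrightarrow> g \<in> units G \<union> T;
      g \<in> fiber G x; convolution_list G as g \<noteq> 0\<rbrakk>
    \<Longrightarrow> \<exists>k\<le>length as. word_product G T x k g"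
proof (induction as arbitrary: g rule: induct_list012)
  case 1
  then show ?case by simp
next
  case (2 a)
  then consider (unit) "g \<in> units G" | (letter) "g \<in> T"
    by auto
  then show ?case
  proof cases
    case unit
    then have "g = x"
      using 2 unit unit_arrow by (auto simp: fiber_def)
    then show ?thesis
      by (intro exI[of _ 0]) (simp add: word_product.empty)
  next
    case letter
    have "gmult G g x = g"
      using 2 mult_origin by (auto simp: fiber_def)
    moreover have "word_product G T x (Suc 0) (gmult G g x)"
      using 2 letter unit_arrow[OF x]
      by (intro word_product.step word_product.empty) (auto simp: fiber_def)
    ultimately show ?thesis
      by auto
  qed
next
  case (3 a b as)
  have "convolution G a (convolution_list G (b # as)) g \<noteq> 0"
    using 3 by simp
  then obtain h where h: "g \<in> arrows G" "h \<in> fiber G (origin G g)"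
      "a (gmult G g (ginv G h)) \<noteq> 0" "convolution_list G (b # as) h \<noteq> 0"
    by (rule convolution_nonzeroE)
  have hx: "h \<in> fiber G x"
    using h 3 by (auto simp: fiber_def)
  then have h': "h \<in> arrows G" "origin G g = origin G h"
    using 3 by (auto simp: fiber_def)
  have "\<exists>k\<le>length (b # as). word_product G T x k h"
  proof (rule "3.IH"(2))
    show "f' \<in> units G \<union> T" if "c \<in> set (b # as)" "c f' \<noteq> 0" for c f'
      using that by (intro "3.prems"(2)[of c]) auto
  qed (use hx h in simp_all)
  then obtain k where k: "k \<le> length (b # as)" "word_product G T x k h"
    by blast
  let ?s = "gmult G g (ginv G h)"
  note s = right_division[OF h(1) h']
  have "?s \<in> units G \<union> T"
    using 3(4)[of a] h by simp
  then consider (unit) "?s \<in> units G" | (letter) "?s \<in> T"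
    by blast
  then show ?case
  proof cases
    case unit
    then have "?s = target G h"
      using s unit_arrow by metis
    then have "g = h"
      using s h' target_mult_left by metis
    then show ?thesis
      using k by (intro exI[of _ k]) simp
  next
    case letter
    then have "word_product G T x (Suc k) (gmult G ?s h)"
      using k s by (intro word_product.step)
    then show ?thesis
      using k s by (intro exI[of _ "Suc k"]) simp
  qed
qed

end

lemma (in topological_groupoid) growth_bound:
  fixes V :: "('g \<Rightarrow> 'k::field) set"
  assumes x: "x \<in> units G" and fin: "finite \<S>" and bis: "\<And>F. F \<in> \<S> \<Longrightarrow> bisection G F"
    and V: "V = fun_space.span (insert (indicator (units G)) (indicator ` \<S>))"
    and n: "n \<ge> 1"
  shows "(\<lambda>a. fiber_action G x a (indicator {x})) ` span_power G V n
    \<subseteq> fun_space.span ((\<lambda>h. indicator {h}) ` cayley_ball G \<S> x n)"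
proof (rule image_subsetI, rule in_span_point_masses)
  show "finite (cayley_ball G \<S> x n)"
    using fin bis by (rule finite_cayley_ball)
next
  fix a :: "'g \<Rightarrow> 'k"
  assume a: "a \<in> span_power G V n"
  let ?T = "\<Union>\<S> \<union> ginv G ` \<Union>\<S>"
  have T: "\<Union>\<S> \<subseteq> arrows G"
    using bisection_subset[OF bis] by auto
  have V_support: "g \<in> units G \<union> \<Union>\<S>" if "v \<in> V" "v g \<noteq> 0" for v g
    using that(1) unfolding V
    by (rule span_supported_on) (use that in \<open>auto simp: indicator_def split: if_splits\<close>)
  \<comment> \<open>Values outside \<open>G\<^sub>x\<close> are left free: only the restriction to \<open>G\<^sub>x\<close> matters, and the condition
    on the support stays linear, so that it passes from products to their span.\<close>
  have product_support: "g \<in> cayley_ball G \<S> x n \<union> - fiber G x"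
    if "length as = n" "set as \<subseteq> V" "convolution_list G as g \<noteq> 0" for as g
  proof (cases "g \<in> fiber G x")
    case True
    have "\<exists>k\<le>length as. word_product G (\<Union>\<S>) x k g"
      using that True n V_support by (intro convolution_list_support[OF x T]) auto
    then show ?thesis
      using True that by (auto simp: cayley_ball_def intro: word_product_mono)
  qed simp
  have "g \<in> cayley_ball G \<S> x n \<union> - fiber G x" if "a g \<noteq> 0" for g
    using a unfolding span_power_def
    by (rule span_supported_on) (use that product_support in auto)
  then show "{g. fiber_action G x a (indicator {x}) g \<noteq> 0} \<subseteq> cayley_ball G \<S> x n"
    by (auto simp: fiber_action_unit_mass[OF x] split: if_splits)
qed


section \<open>The fiber module\<close>

text \<open>
  Convolution sums over possibly infinite fibers; that elements of the algebra meet every fiber in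
  a finite set is what makes \<open>kG\<^sub>x\<close> stable under the action. For a convolution, a nonzero value at \<open>g\<close>
  gives \<open>g = k h\<close> with \<open>h\<close> among the finitely many arrows of the fiber in the support of \<open>f2\<close>, and
  then \<open>k\<close> among the finitely many arrows with origin \<open>target h\<close> in the support of \<open>f1\<close>.
\<close>

lemma (in topological_groupoid) groupoid_algebra_finite_on_fiber:
  assumes "f \<in> groupoid_algebra G" "u \<in> units G"
  shows "finite {g \<in> fiber G u. f g \<noteq> 0}"
  using assms
proof (induction arbitrary: u)
  case (bisection F)
  then have "finite {g \<in> F. origin G g = u}"
    using finite_bisection_fiber by (auto simp: open_compact_bisection_def)
  then show ?case
    by (rule finite_subset[rotated]) (auto simp: fiber_def indicator_def split: if_splits)
next
  case zero
  then show ?case by simp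
next
  case (add f1 f2)
  then have "finite ({g \<in> fiber G u. f1 g \<noteq> 0} \<union> {g \<in> fiber G u. f2 g \<noteq> 0})"
    by simp
  then show ?case
    by (rule finite_subset[rotated]) auto
next
  case (scale f c)
  have "finite {g \<in> fiber G u. f g \<noteq> 0}"
    using scale by simp
  then show ?case
    by (rule finite_subset[rotated]) (auto simp: fscale_def)
next
  case (convolution f1 f2)
  let ?H = "{h \<in> fiber G u. f2 h \<noteq> 0}"
  have "finite (\<Union>h\<in>?H. (\<lambda>k. gmult G k h) ` {k \<in> fiber G (target G h). f1 k \<noteq> 0})"
    using convolution target_in_units by (auto simp: fiber_def)
  then show ?case
  proof (rule finite_subset[rotated], intro subsetI)
    fix g
    assume "g \<in> {g \<in> fiber G u. convolution G f1 f2 g \<noteq> 0}"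
    then have g: "g \<in> arrows G" "origin G g = u" and "convolution G f1 f2 g \<noteq> 0"
      by (auto simp: fiber_def)
    from this(3) obtain h where h: "h \<in> fiber G u" "f1 (gmult G g (ginv G h)) \<noteq> 0" "f2 h \<noteq> 0"
      using g by (auto elim: convolution_nonzeroE)
    then have h': "h \<in> arrows G" "origin G g = origin G h"
      using g by (auto simp: fiber_def)
    have "g \<in> (\<lambda>k. gmult G k h) ` {k \<in> fiber G (target G h). f1 k \<noteq> 0}"
      using right_division[OF g(1) h'] h
      by (intro image_eqI[of _ _ "gmult G g (ginv G h)"]) (auto simp: fiber_def)
    then show "g \<in> (\<Union>h\<in>?H. (\<lambda>k. gmult G k h) ` {k \<in> fiber G (target G h). f1 k \<noteq> 0})"
      using h by blast
  qed
qed

lemma (in topological_groupoid) fiber_action_closed: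
  assumes a: "a \<in> groupoid_algebra G" and \<phi>: "\<phi> \<in> fiber_module G x"
  shows "fiber_action G x a \<phi> \<in> fiber_module G x"
proof -
  let ?H = "{h. \<phi> h \<noteq> 0}"
  let ?S = "\<Union>h\<in>?H. (\<lambda>k. gmult G k h) ` {k \<in> fiber G (target G h). a k \<noteq> 0}"
  have H: "finite ?H" "?H \<subseteq> fiber G x"
    using \<phi> by (auto simp: fiber_module_def)
  have "finite ?S"
    using H groupoid_algebra_finite_on_fiber[OF a] target_in_units by (auto simp: fiber_def)
  moreover have "{g. fiber_action G x a \<phi> g \<noteq> 0} \<subseteq> ?S"
  proof
    fix g
    assume "g \<in> {g. fiber_action G x a \<phi> g \<noteq> 0}"
    then obtain h where h: "g \<in> fiber G x" "h \<in> fiber G x" "a (gmult G g (ginv G h)) \<noteq> 0" "\<phi> h \<noteq> 0"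
      by (auto elim: fiber_action_nonzeroE)
    then have "g \<in> arrows G" "h \<in> arrows G" "origin G g = origin G h"
      by (auto simp: fiber_def)
    note d = right_division[OF this]
    have "g \<in> (\<lambda>k. gmult G k h) ` {k \<in> fiber G (target G h). a k \<noteq> 0}"
      using d h by (intro image_eqI[of _ _ "gmult G g (ginv G h)"]) (auto simp: fiber_def)
    then show "g \<in> ?S"
      using h by blast
  qed
  ultimately show ?thesis
    by (auto simp: fiber_module_def intro: finite_subset elim: fiber_action_nonzeroE)
qed

lemma (in topological_groupoid) continuous_origin:
  "continuous_map (gtop G) (unit_space G) (origin G)"
proof -
  let ?P = "subtopology (prod_topology (gtop G) (gtop G))
    {(g, h). g \<in> arrows G \<and> h \<in> arrows G \<and> origin G g = target G h}"
  have "continuous_map (gtop G) ?P (\<lambda>g. (ginv G g, g))"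
    using continuous_inv
    by (intro continuous_map_into_subtopology continuous_map_pairedI)
      (auto simp: topspace_gtop inv_closed origin_inv)
  then have "continuous_map (gtop G) (gtop G) ((\<lambda>(g, h). gmult G g h) \<circ> (\<lambda>g. (ginv G g, g)))"
    using continuous_mult by (rule continuous_map_compose)
  then have "continuous_map (gtop G) (gtop G) (origin G)"
    by (simp add: o_def origin_def[abs_def])
  then show ?thesis
    unfolding unit_space_def
    by (rule continuous_map_into_subtopology) (auto simp: topspace_gtop origin_in_units)
qed

text \<open>
  The origins of an open bisection form an open set of units, so the bisection can be cut down to
  the arrows whose origin lies in a small clopen set \<open>W\<close>. The result is compact because the origin
  map identifies it with \<open>W\<close>.
\<close>

lemma (in etale_groupoid) open_compact_bisection_through:
  assumes compact: "compact_space (unit_space G)" and Hausdorff: "Hausdorff_space (unit_space G)"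
    and td: "totally_disconnected_space (unit_space G)"
    and k: "k \<in> arrows G" and U: "openin (unit_space G) U" "origin G k \<in> U"
  obtains F where "open_compact_bisection G F" "k \<in> F" "origin G ` F \<subseteq> U"
proof -
  have "openin (gtop G) (arrows G)"
    by (metis openin_topspace topspace_gtop)
  then have "(arbitrary union_of (\<lambda>F. openin (gtop G) F \<and> bisection G F)) (arrows G)"
    by (rule fun_cong[OF bisections_basis, THEN iffD1])
  then obtain \<B> where "\<B> \<subseteq> Collect (\<lambda>F. openin (gtop G) F \<and> bisection G F)" "\<Union>\<B> = arrows G"
    unfolding union_of_def by metis
  with k obtain E where E: "openin (gtop G) E" "bisection G E" "k \<in> E"
    by blast
  have EG: "E \<subseteq> arrows G"
    using E by (simp add: bisection_subset)
  have "openin (unit_space G) (U \<inter> origin G ` E)"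
    using U E origin_open by (auto simp: open_map_def)
  moreover have "origin G k \<in> U \<inter> origin G ` E"
    using U E by blast
  ultimately obtain W where W: "closedin (unit_space G) W" "openin (unit_space G) W"
      "origin G k \<in> W" "W \<subseteq> U \<inter> origin G ` E"
    using clopen_neighbourhood[OF compact Hausdorff td] by metis
  define F where "F = E \<inter> {g \<in> topspace (gtop G). origin G g \<in> W}"
  have F: "F \<subseteq> E" "origin G ` F = W"
    using W(4) EG by (fastforce simp: F_def topspace_gtop)+
  have homeo: "homeomorphic_map (subtopology (gtop G) E) (subtopology (gtop G) (origin G ` E)) (origin G)"
      "homeomorphic_map (subtopology (gtop G) E) (subtopology (gtop G) (target G ` E)) (target G)"
    using E by (auto simp: bisection_def)
  have restrict: "homeomorphic_map (subtopology (gtop G) F) (subtopology (gtop G) (f ` F)) f"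
    if f: "homeomorphic_map (subtopology (gtop G) E) (subtopology (gtop G) (f ` E)) f" for f
  proof -
    have sub: "E \<inter> F = F" "f ` E \<inter> f ` F = f ` F"
      using F by auto
    have "f ` topspace (subtopology (gtop G) E) = topspace (subtopology (gtop G) (f ` E))"
      using f by (rule homeomorphic_imp_surjective_map)
    then have "f ` E \<subseteq> topspace (gtop G)"
      using EG by (auto simp: topspace_gtop)
    then have "f ` (topspace (subtopology (gtop G) E) \<inter> F)
        = topspace (subtopology (gtop G) (f ` E)) \<inter> f ` F"
      using F EG by (auto simp: topspace_gtop)
    from homeomorphic_map_subtopologies[OF f this] show ?thesis
      by (simp add: subtopology_subtopology sub)
  qed
  have "bisection G F"
    unfolding bisection_def using F EG homeo restrict by blast
  moreover have "openin (gtop G) F"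
    unfolding F_def using E W continuous_origin openin_continuous_map_preimage by blast
  moreover have "compactin (gtop G) F"
  proof -
    have "compactin (unit_space G) W"
      using compact W by (simp add: closedin_compact_space)
    then have "compactin (subtopology (gtop G) (origin G ` E)) (origin G ` F)"
      using W F by (auto simp: unit_space_def compactin_subtopology)
    then have "compactin (subtopology (gtop G) E) F"
      using homeomorphic_map_compactness[OF homeo(1), of F] F EG by (auto simp: topspace_gtop)
    then show ?thesis
      by (simp add: compactin_subtopology)
  qed
  ultimately have "open_compact_bisection G F"
    by (simp add: open_compact_bisection_def)
  moreover have "k \<in> F"
    using E W k by (simp add: F_def topspace_gtop)
  ultimately show thesis
    using that F W by blast
qed

text \<open>
  Among the arrows \<open>g'\<close> in the support of \<open>\<phi>\<close>, only \<open>g\<close> can be composed with an element of \<open>F\<close>, and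
  that element is \<open>h g\<^sup>-\<^sup>1\<close>, because a bisection has at most one arrow with a given origin.
\<close>

lemma (in topological_groupoid) isolating_bisection_action:
  fixes \<phi> :: "'g \<Rightarrow> 'k::field"
  assumes \<phi>: "\<phi> \<in> fiber_module G x" and gx: "g \<in> fiber G x" and hx: "h \<in> fiber G x"
    and F: "bisection G F" "gmult G h (ginv G g) \<in> F"
    and avoid: "\<And>g'. \<phi> g' \<noteq> 0 \<Longrightarrow> g' \<noteq> g \<Longrightarrow> target G g' \<notin> origin G ` F"
  shows "fiber_action G x (fscale c (indicator F)) \<phi> = fscale (c * \<phi> g) (indicator {h})"
proof
  fix f
  have g: "g \<in> arrows G" "origin G g = x" and h: "h \<in> arrows G" "origin G h = x"
    using gx hx by (auto simp: fiber_def)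
  then have hg: "origin G h = origin G g"
    by simp
  show "fiber_action G x (fscale c (indicator F)) \<phi> f = fscale (c * \<phi> g) (indicator {h}) f"
  proof (cases "f \<in> fiber G x")
    case True
    then have f: "f \<in> arrows G" "origin G f = x"
      by (auto simp: fiber_def)
    \<comment> \<open>Inserting \<open>g\<close> covers the case \<open>\<phi> g = 0\<close>, where both sides vanish.\<close>
    let ?S = "insert g {g'. \<phi> g' \<noteq> 0}"
    let ?term = "\<lambda>g'. fscale c (indicator F) (gmult G f (ginv G g')) * \<phi> g'"
    have S: "finite ?S" "?S \<subseteq> fiber G x"
      using \<phi> gx by (auto simp: fiber_module_def)
    then have "fiber_action G x (fscale c (indicator F)) \<phi> f = (\<Sum>g'\<in>?S. ?term g')"
      using True by (intro fiber_action_eq_sum) auto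
    also have "\<dots> = (\<Sum>g'\<in>{g}. ?term g')"
    proof (rule sum.mono_neutral_right)
      show "\<forall>g'\<in>?S - {g}. ?term g' = 0"
      proof
        fix g'
        assume g': "g' \<in> ?S - {g}"
        then have "g' \<in> arrows G" "origin G f = origin G g'"
          using S f by (auto simp: fiber_def)
        then have "origin G (gmult G f (ginv G g')) = target G g'"
          using f right_division by blast
        then have "gmult G f (ginv G g') \<notin> F"
          using avoid[of g'] g' by force
        then show "?term g' = 0"
          by (simp add: fscale_def)
      qed
    qed (use S in auto)
    also have "\<dots> = ?term g"
      by simp
    also have "\<dots> = fscale (c * \<phi> g) (indicator {h}) f"
    proof (cases "f = h")
      case True
      then show ?thesis
        using F by (simp add: fscale_def)
    next
      case False
      have "gmult G f (ginv G g) \<notin> F"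
      proof
        assume in_F: "gmult G f (ginv G g) \<in> F"
        have fg: "origin G f = origin G g"
          using f g by simp
        note d = right_division[OF f(1) g(1) fg] and e = right_division[OF h(1) g(1) hg]
        have "gmult G f (ginv G g) = gmult G h (ginv G g)"
          using bisection_inj(1)[OF F(1)] in_F F(2) d(2) e(2) by (simp add: inj_on_def)
        then have "f = h"
          using d(4) e(4) by metis
        with False show False ..
      qed
      then show ?thesis
        using False by (simp add: fscale_def)
    qed
    finally show ?thesis .
  next
    case False
    then have "f \<noteq> h"
      using hx by blast
    then show ?thesis
      using False by (simp add: fiber_action_def fscale_def)
  qed
qed

text \<open>
  The unit space is Hausdorff, so the finitely many targets of the support of \<open>\<phi>\<close> other than
  \<open>target g\<close> form a closed set; a bisection through \<open>h g\<^sup>-\<^sup>1\<close> avoiding it sends \<open>\<phi>\<close> to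
  \<open>\<phi> g \<delta>\<^sub>h\<close>. The factor \<open>c / \<phi> g\<close> is absorbed into the algebra element.
\<close>

lemma (in etale_groupoid) point_mass_in_submodule:
  fixes N :: "('g \<Rightarrow> 'k::field) set"
  assumes compact: "compact_space (unit_space G)" and Hausdorff: "Hausdorff_space (unit_space G)"
    and td: "totally_disconnected_space (unit_space G)"
    and isotropy: "isotropy G x = {x}"
    and N: "submodule (groupoid_algebra G) (fiber_action G x) (fiber_module G x) N"
    and \<phi>: "\<phi> \<in> N" "\<phi> g \<noteq> 0" and hx: "h \<in> fiber G x"
  shows "fscale c (indicator {h}) \<in> N"
proof -
  have \<phi>M: "\<phi> \<in> fiber_module G x"
    using N \<phi> by (auto simp: submodule_def)
  then have gx: "g \<in> fiber G x" and fin: "finite {g. \<phi> g \<noteq> 0}" and sub: "{g. \<phi> g \<noteq> 0} \<subseteq> fiber G x"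
    using \<phi> by (auto simp: fiber_module_def)
  define Z where "Z = target G ` ({g'. \<phi> g' \<noteq> 0} - {g})"
  have topspace: "topspace (unit_space G) = units G"
    using unit_arrow by (auto simp: unit_space_def topspace_gtop)
  have "finite Z" "Z \<subseteq> units G"
    using fin sub target_in_units by (auto simp: Z_def fiber_def)
  then have "closedin (unit_space G) Z"
    using Hausdorff Hausdorff_imp_t1_space t1_space_closedin_finite topspace by metis
  then have U: "openin (unit_space G) (units G - Z)"
    using openin_diff openin_topspace topspace by metis
  have g: "g \<in> arrows G" and h: "h \<in> arrows G" and hg: "origin G h = origin G g"
    using gx hx by (auto simp: fiber_def)
  note d = right_division[OF h g hg]
  have "target G g \<notin> Z"
    using target_inj_on_fiber[OF isotropy] gx sub by (auto simp: Z_def inj_on_def)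
  then have "origin G (gmult G h (ginv G g)) \<in> units G - Z"
    using d target_in_units[OF g] by simp
  then obtain F where F: "open_compact_bisection G F" "gmult G h (ginv G g) \<in> F"
      "origin G ` F \<subseteq> units G - Z"
    using open_compact_bisection_through[OF compact Hausdorff td d(1) U] by metis
  let ?a = "fscale (c / \<phi> g) (indicator F) :: 'g \<Rightarrow> 'k"
  have "fiber_action G x ?a \<phi> = fscale (c / \<phi> g * \<phi> g) (indicator {h})"
    using F \<phi>M gx hx
    by (intro isolating_bisection_action) (auto simp: open_compact_bisection_def Z_def)
  then have "fiber_action G x ?a \<phi> = fscale c (indicator {h})"
    using \<phi> by simp
  moreover have "?a \<in> groupoid_algebra G"
    using F by (intro groupoid_algebra.scale groupoid_algebra.bisection)
  ultimately show ?thesis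
    using N \<phi> by (metis submodule_def)
qed

lemma (in etale_groupoid) simple_fiber_module:
  assumes compact: "compact_space (unit_space G)" and Hausdorff: "Hausdorff_space (unit_space G)"
    and td: "totally_disconnected_space (unit_space G)"
    and x: "x \<in> units G" and isotropy: "isotropy G x = {x}"
  shows "simple_module (groupoid_algebra G :: ('g \<Rightarrow> 'k::field) set)
    (fiber_action G x) (fiber_module G x)"
  unfolding simple_module_def
proof (intro conjI allI impI)
  let ?M = "fiber_module G x :: ('g \<Rightarrow> 'k) set"
  have add: "u + v \<in> ?M" if "u \<in> ?M" "v \<in> ?M" for u v
  proof -
    have "{g. (u + v) g \<noteq> 0} \<subseteq> {g. u g \<noteq> 0} \<union> {g. v g \<noteq> 0}"
      by auto
    then show ?thesis
      using that unfolding fiber_module_def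
      by (auto dest: finite_subset)
  qed
  show "submodule (groupoid_algebra G) (fiber_action G x) ?M ?M"
    unfolding submodule_def
  proof (intro conjI ballI)
    show "0 \<in> ?M"
      by (simp add: fiber_module_def)
    show "- u \<in> ?M" if "u \<in> ?M" for u
      using that by (simp add: fiber_module_def fun_Compl_def)
  qed (use add fiber_action_closed in auto)
  have "indicator {x} \<in> ?M"
    using unit_arrow[OF x]
    by (auto simp: fiber_module_def fiber_def indicator_def)
  moreover have "(indicator {x} :: 'g \<Rightarrow> 'k) \<noteq> 0"
    by (auto simp: fun_eq_iff intro: exI[of _ x])
  ultimately show "?M \<noteq> {0}"
    by blast
  fix N :: "('g \<Rightarrow> 'k) set"
  assume N: "submodule (groupoid_algebra G) (fiber_action G x) ?M N"
  show "N = {0} \<or> N = ?M"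
  proof (cases "N = {0}")
    case False
    moreover have "0 \<in> N"
      using N by (simp add: submodule_def)
    ultimately obtain \<phi> where "\<phi> \<in> N" "\<phi> \<noteq> 0"
      by blast
    then obtain g where g: "\<phi> g \<noteq> 0"
      by (auto simp: fun_eq_iff)
    have "\<psi> \<in> N" if \<psi>: "\<psi> \<in> ?M" for \<psi>
    proof (rule finitely_supported_in_additive_set)
      show "finite {g. \<psi> g \<noteq> 0}" "{g. \<psi> g \<noteq> 0} \<subseteq> {g. \<psi> g \<noteq> 0}"
        using \<psi> by (auto simp: fiber_module_def)
      show "0 \<in> N" "\<And>u v. u \<in> N \<Longrightarrow> v \<in> N \<Longrightarrow> u + v \<in> N"
        using N by (auto simp: submodule_def)
      show "fscale c (indicator {h}) \<in> N" if "h \<in> {g. \<psi> g \<noteq> 0}" for c h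
        using that \<psi>
        by (intro point_mass_in_submodule[OF compact Hausdorff td isotropy N \<open>\<phi> \<in> N\<close> g])
          (auto simp: fiber_module_def)
    qed
    then show ?thesis
      using N by (auto simp: submodule_def)
  qed simp
qed


section \<open>Growth and simplicity of the fiber module\<close>

theorem proposition4p8:
  fixes G :: "'g top_groupoid" and x :: 'g and \<S> :: "'g set set"
    and V :: "('g \<Rightarrow> 'k::field) set"
  assumes etale: "etale_groupoid G"
    and minimal: "minimal_groupoid G"
    and compact: "compact_space (unit_space G)"
    and totally_disconnected: "totally_disconnected_space (unit_space G)"
    and metrizable: "metrizable_space (unit_space G)"
    and x: "x \<in> units G"
    and finite_S: "finite \<S>"
    and bisections_S: "\<And>F. F \<in> \<S> \<Longrightarrow> open_compact_bisection G F"
    and V_def: "V = fun_space.span (insert (indicator (units G)) (indicator ` \<S>))"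
  shows "(\<forall>n\<ge>1. finite (cayley_ball G \<S> x n) \<and>
            (\<exists>B. finite B \<and>
              (\<lambda>a. fiber_action G x a (indicator {x})) ` span_power G V n \<subseteq> fun_space.span B) \<and>
            fun_space.dim ((\<lambda>a. fiber_action G x a (indicator {x})) ` span_power G V n)
              \<le> cayley_growth G \<S> x n)
       \<and> (isotropy G x = {x} \<longrightarrow>
            simple_module (groupoid_algebra G :: ('g \<Rightarrow> 'k) set) (fiber_action G x) (fiber_module G x))"
proof -
  interpret etale_groupoid G
    by (rule etale)
  have bis: "bisection G F" if "F \<in> \<S>" for F
    using bisections_S[OF that] by (simp add: open_compact_bisection_def)
  have ball: "finite (cayley_ball G \<S> x n)" for n
    using finite_S bis by (rule finite_cayley_ball)
  let ?W = "\<lambda>n. (\<lambda>a. fiber_action G x a (indicator {x})) ` span_power G V n"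
  let ?B = "\<lambda>n. (\<lambda>h. indicator {h} :: 'g \<Rightarrow> 'k) ` cayley_ball G \<S> x n"
  have sub: "?W n \<subseteq> fun_space.span (?B n)" if "n \<ge> 1" for n
    using x finite_S bis V_def that by (rule growth_bound)
  have dim: "fun_space.dim (?W n) \<le> cayley_growth G \<S> x n" if "n \<ge> 1" for n
  proof -
    have "fun_space.dim (?W n) \<le> card (?B n)"
      using sub[OF that] ball by (intro fun_space.dim_le_card) auto
    also have "\<dots> \<le> cayley_growth G \<S> x n"
      unfolding cayley_growth_def using ball by (rule card_image_le)
    finally show ?thesis .
  qed
  have Hausdorff: "Hausdorff_space (unit_space G)"
    using metrizable by (rule metrizable_imp_Hausdorff_space)
  show ?thesis
  proof (intro conjI allI impI)
    fix n :: nat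
    assume n: "n \<ge> 1"
    show "finite (cayley_ball G \<S> x n)"
      by (rule ball)
    show "\<exists>B. finite B \<and> ?W n \<subseteq> fun_space.span B"
      using sub[OF n] ball by (intro exI[of _ "?B n"]) auto
    show "fun_space.dim (?W n) \<le> cayley_growth G \<S> x n"
      using n by (rule dim)
  next
    assume "isotropy G x = {x}"
    with compact Hausdorff totally_disconnected x
    show "simple_module (groupoid_algebra G :: ('g \<Rightarrow> 'k) set) (fiber_action G x) (fiber_module G x)"
      by (rule simple_fiber_module)
  qed
qed

end
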